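(* Let $G_0$ and $G_1$ be finite, simple, connected, rooted graphs, each with at least one edge. Let $N_0$ be the connected graph obtained from the disjoint union of $G_0$ and $G_1$ by joining the two roots with an edge $e$ and, for an integer $k\geq 1$, let $N_k$ be the graph obtained from $N_0$ by subdividing $e$ $k$ times (i.e. replacing $e$ by a path with $k$ new interior vertices). Then \[\mathbb{H}_{*+k}(N_k)\cong\mathbb{H}_*(N_0),\] where $\mathbb{H}$ denotes bold homology with coefficients in a field.
   Context: Bold homology. Let $G$ be a finite simple graph and $\mathbb{K}$ a field; order $V(G)$. A bi-colouring is a map $\varepsilon\colon V(G)\to\{0,1\}$, and $G_\varepsilon$ denotes the subgraph of $G$ induced by the vertices $v$ with $\varepsilon(v)=1$. Write $\varepsilon\,\widetilde{\triangleleft}\,\varepsilon'$ if $\varepsilon'$ is obtained from $\varepsilon$ by changing the value at exactly one vertex from $0$ to $1$. A sign assignment is a choice of $s(\varepsilon,\varepsilon')\in\mathbb{Z}/2$ for each such pair with $s(\varepsilon,\varepsilon_1)+s(\varepsilon_1,\varepsilon'')\equiv s(\varepsilon,\varepsilon_2)+s(\varepsilon_2,\varepsilon'')+1\pmod 2$ whenever $\varepsilon\,\widetilde{\triangleleft}\,\varepsilon_1,\varepsilon_2\,\widetilde{\triangleleft}\,\varepsilon''$, $\varepsilon_1\neq\varepsilon_2$; it exists and the choice does not affect the complex up to isomorphism. The bold chain group is \[\mathrm{C}\mathbb{H}_i(G)=\bigoplus_{\varepsilon:\ \sum_v\varepsilon(v)=i}\ \bigoplus_{x\in\pi_0(G_\varepsilon)}\mathbb{K}\langle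 x\rangle,\] where $\pi_0$ is the set of connected components (so $\mathrm{C}\mathbb{H}_0=0$), with differential $d^i\colon \mathrm{C}\mathbb{H}_i\to\mathrm{C}\mathbb{H}_{i+1}$ given for $x\in\pi_0(G_\varepsilon)$ by $d^i(x)=\sum(-1)^{s(\varepsilon,\varepsilon')}y$, the sum over all $\varepsilon'$ with $\varepsilon\,\widetilde{\triangleleft}\,\varepsilon'$ and the component $y\in\pi_0(G_{\varepsilon'})$ with $V(x)\subseteq V(y)$. Its homology is the bold homology $\mathbb{H}_*(G)$. *)

theory Defs
  imports
    "Graph_Theory.Graph_Theory"
    "HOL-Library.Z2"
    "HOL-Library.Function_Algebras"
    "HOL-Library.Set_Algebras"
begin

text \<open>
  A finite simple graph is a \<open>pair_graph\<close>: a finite, symmetric, loop-free set of arcs, each edge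
  being represented by its two orientations. A bi-colouring of \<open>G\<close> is identified with the set
  \<open>S \<subseteq> pverts G\<close> of the vertices of colour 1.
\<close>

text \<open>
  Components are given by their vertex sets. For a symmetric arc set, the strongly connected
  components are the ordinary ones.
\<close>
definition components :: "'a pair_pre_digraph \<Rightarrow> 'a set \<Rightarrow> 'a set set" where
  "components G S = pre_digraph.sccs_verts (with_proj G \<restriction> S)"

definition cover :: "'a pair_pre_digraph \<Rightarrow> 'a set \<Rightarrow> 'a set \<Rightarrow> bool" where
  "cover G S S' \<longleftrightarrow> S \<subseteq> pverts G \<and> (\<exists>v \<in> pverts G - S. S' = insert v S)"

definition sign_assignment :: "'a pair_pre_digraph \<Rightarrow> ('a set \<Rightarrow> 'a set \<Rightarrow> bit) \<Rightarrow> bool" where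
  "sign_assignment G s \<longleftrightarrow>
    (\<forall>S S1 S2 S''. cover G S S1 \<and> cover G S S2 \<and> cover G S1 S'' \<and> cover G S2 S'' \<and> S1 \<noteq> S2
       \<longrightarrow> s S S1 + s S1 S'' = s S S2 + s S2 S'' + 1)"

text \<open>
  A generator \<open>(S, x)\<close> is a component \<open>x\<close> of the subgraph induced by \<open>S\<close>; its degree is the number
  of vertices of colour 1. Degrees are integers, so that the complex is zero in negative degrees.
\<close>
definition bold_gens :: "'a pair_pre_digraph \<Rightarrow> int \<Rightarrow> ('a set \<times> 'a set) set" where
  "bold_gens G i = {(S, x). S \<subseteq> pverts G \<and> int (card S) = i \<and> x \<in> components G S}"

type_synonym ('a, 'k) chain = "'a set \<times> 'a set \<Rightarrow> 'k"

text \<open>A chain is given by its coefficients; there are only finitely many generators.\<close>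
definition bold_chains :: "'a pair_pre_digraph \<Rightarrow> int \<Rightarrow> ('a, 'k::field) chain set" where
  "bold_chains G i = {c. \<forall>g. g \<notin> bold_gens G i \<longrightarrow> c g = 0}"

definition bold_diff_gen ::
  "'a pair_pre_digraph \<Rightarrow> ('a set \<Rightarrow> 'a set \<Rightarrow> bit) \<Rightarrow> 'a set \<times> 'a set \<Rightarrow> ('a, 'k::field) chain" where
  "bold_diff_gen G s = (\<lambda>(S, x) (S', y).
     if cover G S S' \<and> y \<in> components G S' \<and> x \<subseteq> y
     then (if s S S' = 0 then 1 else - 1) else 0)"

definition bold_diff ::
  "'a pair_pre_digraph \<Rightarrow> ('a set \<Rightarrow> 'a set \<Rightarrow> bit) \<Rightarrow> int \<Rightarrow> ('a, 'k::field) chain \<Rightarrow> ('a, 'k) chain"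
  where
  "bold_diff G s i c = (\<lambda>h. \<Sum>g \<in> bold_gens G i. c g * bold_diff_gen G s g h)"

definition bold_cycles ::
  "'a pair_pre_digraph \<Rightarrow> ('a set \<Rightarrow> 'a set \<Rightarrow> bit) \<Rightarrow> int \<Rightarrow> ('a, 'k::field) chain set" where
  "bold_cycles G s i = {c \<in> bold_chains G i. bold_diff G s i c = 0}"

definition bold_boundaries ::
  "'a pair_pre_digraph \<Rightarrow> ('a set \<Rightarrow> 'a set \<Rightarrow> bit) \<Rightarrow> int \<Rightarrow> ('a, 'k::field) chain set" where
  "bold_boundaries G s i = bold_diff G s (i - 1) ` bold_chains G (i - 1)"

text \<open>
  The homology as the set of cosets of the boundaries. Cosets are added by the elementwise sum
  \<open>X + Y\<close> of sets; in the scalar product, adding the boundaries makes \<open>0 \<cdot> X\<close> the zero coset.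
\<close>
definition bold_homology ::
  "'a pair_pre_digraph \<Rightarrow> ('a set \<Rightarrow> 'a set \<Rightarrow> bit) \<Rightarrow> int \<Rightarrow> ('a, 'k::field) chain set set" where
  "bold_homology G s i = (\<lambda>z. z +o bold_boundaries G s i) ` bold_cycles G s i"

definition bold_scale ::
  "'a pair_pre_digraph \<Rightarrow> ('a set \<Rightarrow> 'a set \<Rightarrow> bit) \<Rightarrow> int \<Rightarrow> 'k::field
    \<Rightarrow> ('a, 'k) chain set \<Rightarrow> ('a, 'k) chain set" where
  "bold_scale G s i a X = (\<lambda>x g. a * x g) ` X + bold_boundaries G s i"

definition bold_homology_iso ::
  "'a pair_pre_digraph \<Rightarrow> ('a set \<Rightarrow> 'a set \<Rightarrow> bit) \<Rightarrow> int
    \<Rightarrow> 'b pair_pre_digraph \<Rightarrow> ('b set \<Rightarrow> 'b set \<Rightarrow> bit) \<Rightarrow> int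
    \<Rightarrow> (('a, 'k::field) chain set \<Rightarrow> ('b, 'k) chain set) \<Rightarrow> bool" where
  "bold_homology_iso G s i G' s' j \<phi> \<longleftrightarrow>
     bij_betw \<phi> (bold_homology G s i) (bold_homology G' s' j) \<and>
     (\<forall>X \<in> bold_homology G s i. \<forall>Y \<in> bold_homology G s i. \<phi> (X + Y) = \<phi> X + \<phi> Y) \<and>
     (\<forall>a. \<forall>X \<in> bold_homology G s i. \<phi> (bold_scale G s i a X) = bold_scale G' s' j a (\<phi> X))"

datatype ('a, 'b) join_vertex = Of0 'a | Of1 'b | New nat

text \<open>
  The graphs \<open>N\<^sub>k\<close>. The \<open>k\<close>-th subdivision step inserts \<open>New k\<close> into the edge between the last
  vertex inserted so far (the root \<open>r0\<close> if there is none) and the root \<open>r1\<close>.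
\<close>
primrec join_subdivided ::
  "'a pair_pre_digraph \<Rightarrow> 'a \<Rightarrow> 'b pair_pre_digraph \<Rightarrow> 'b \<Rightarrow> nat \<Rightarrow> ('a, 'b) join_vertex pair_pre_digraph"
  where
  "join_subdivided G0 r0 G1 r1 0 =
     \<lparr> pverts = Of0 ` pverts G0 \<union> Of1 ` pverts G1,
       parcs = map_prod Of0 Of0 ` parcs G0 \<union> map_prod Of1 Of1 ` parcs G1
               \<union> {(Of0 r0, Of1 r1), (Of1 r1, Of0 r0)} \<rparr>"
| "join_subdivided G0 r0 G1 r1 (Suc k) =
     subdivide (join_subdivided G0 r0 G1 r1 k)
       (if k = 0 then Of0 r0 else New k, Of1 r1) (New (Suc k))"

definition join_path :: "'a \<Rightarrow> 'b \<Rightarrow> nat \<Rightarrow> nat \<Rightarrow> ('a, 'b) join_vertex" where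
  "join_path r0 r1 k j = (if j = 0 then Of0 r0 else if j \<le> k then New j else Of1 r1)"

lemma pverts_join_subdivided:
  "pverts (join_subdivided G0 r0 G1 r1 k) = Of0 ` pverts G0 \<union> Of1 ` pverts G1 \<union> New ` {1..k}"
  by (induction k) (auto simp: subdivide.simps)

lemma parcs_join_subdivided:
  "parcs (join_subdivided G0 r0 G1 r1 k) =
     map_prod Of0 Of0 ` parcs G0 \<union> map_prod Of1 Of1 ` parcs G1
     \<union> (\<Union>j \<le> k. {(join_path r0 r1 k j, join_path r0 r1 k (Suc j)),
                 (join_path r0 r1 k (Suc j), join_path r0 r1 k j)})"
proof (induction k)
  case 0
  then show ?case by (auto simp: join_path_def)
next
  case (Suc k)
  let ?u = "if k = 0 then Of0 r0 else New k"
  let ?P = "\<Union>j < k. {(join_path r0 r1 k j, join_path r0 r1 k (Suc j)),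
                     (join_path r0 r1 k (Suc j), join_path r0 r1 k j)}"
  have P: "(\<Union>j < k. {(join_path r0 r1 (Suc k) j, join_path r0 r1 (Suc k) (Suc j)),
                     (join_path r0 r1 (Suc k) (Suc j), join_path r0 r1 (Suc k) j)}) = ?P"
    by (rule SUP_cong) (simp_all add: join_path_def)
  have *: "(\<Union>j \<le> k. {(join_path r0 r1 k j, join_path r0 r1 k (Suc j)),
                     (join_path r0 r1 k (Suc j), join_path r0 r1 k j)})
           = {(?u, Of1 r1), (Of1 r1, ?u)} \<union> ?P"
    by (simp only: lessThan_Suc_atMost[symmetric] lessThan_Suc UN_insert) (simp add: join_path_def)
  have **: "(\<Union>j \<le> Suc k. {(join_path r0 r1 (Suc k) j, join_path r0 r1 (Suc k) (Suc j)),
                     (join_path r0 r1 (Suc k) (Suc j), join_path r0 r1 (Suc k) j)})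
           = {(New (Suc k), Of1 r1), (Of1 r1, New (Suc k))}
             \<union> ({(?u, New (Suc k)), (New (Suc k), ?u)} \<union> ?P)"
    by (simp only: lessThan_Suc_atMost[symmetric] lessThan_Suc UN_insert P) (simp add: join_path_def)
  have disj: "?P \<inter> {(?u, Of1 r1), (Of1 r1, ?u)} = {}"
    by (auto simp: join_path_def split: if_splits)
  have disj': "(map_prod Of0 Of0 ` parcs G0 \<union> map_prod Of1 Of1 ` parcs G1)
      \<inter> {(?u, Of1 r1), (Of1 r1, ?u)} = {}"
    by (auto split: if_splits)
  have aux: "(A \<union> ({a, b} \<union> P)) - {a, b} \<union> {c, d, e, f} = A \<union> ({e, f} \<union> ({c, d} \<union> P))"
    if "A \<inter> {a, b} = {}" "P \<inter> {a, b} = {}" for A P :: "'z set" and a b c d e f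
    using that by blast
  show ?case
    unfolding join_subdivided.simps subdivide.simps Suc.IH * ** pair_pre_digraph.simps
    by (rule aux[OF disj' disj])
qed

end

theory Submission
  imports Defs
begin

text \<open>
  The isomorphism holds because both sides are zero: the bold homology of a finite graph vanishes
  whenever the graph has at least three vertices and a bridge that splits it into two nonempty
  parts. Each \<open>N\<^sub>k\<close> is such a graph. Take for \<open>A\<close> the vertices of \<open>G\<^sub>0\<close> and for \<open>B\<close> all
  others. A single edge joins \<open>A\<close> and \<open>B\<close>, leaving \<open>A\<close> at the root, and \<open>A\<close> has a further
  vertex \<open>a\<close> because \<open>G\<^sub>0\<close> has an edge.

  The elementary source of vanishing is the toggling of a vertex \<open>t\<close>. If the generators over \<open>S\<close>
  are the same as those over \<open>S \<union> {t}\<close>, then moving generators from \<open>S \<union> {t}\<close> to \<open>S\<close> contracts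
  the complex (\<open>cube_diff_toggle\<close>). The bold complex is put together from two complexes of
  this kind. The components that meet \<open>A\<close> span a subcomplex. Intersecting with \<open>A\<close> identifies them
  with the components of the subgraph induced by \<open>S \<inter> A\<close>, because a path that leaves \<open>A\<close> must use the
  only edge to \<open>B\<close> and return through it; hence any \<open>b \<in> B\<close> can be toggled. The quotient
  is spanned by the components contained in \<open>B\<close>. They do not notice the presence of \<open>a\<close>, which
  has no neighbour in \<open>B\<close>, so \<open>a\<close> can be toggled. Both the subcomplex and the quotient are acyclic,
  and so is the bold complex (\<open>cycle_is_boundary\<close>).
\<close>

section \<open>Signed cube complexes\<close>

definition bit_sign :: "bit \<Rightarrow> 'k::field" where
  "bit_sign b = (if b = 0 then 1 else - 1)"

lemma bit_sign_mult_self [simp]: "bit_sign b * bit_sign b = 1"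
  and bit_sign_mult_self_left [simp]: "bit_sign b * (bit_sign b * x) = x"
  by (auto simp: bit_sign_def)

lemma bit_sign_anticommute:
  assumes "a + b = c + d + 1"
  shows "bit_sign a * bit_sign b = - (bit_sign c * bit_sign d :: 'k::field)"
  using assms by (cases a; cases b; cases c; cases d) (auto simp: bit_sign_def)

text \<open>
  A cube complex is given by a family \<open>X\<close>, where \<open>X S\<close> is the set of generators over the vertex set
  \<open>S\<close>. A generator is itself a set of vertices and is sent to the generators over larger \<open>S\<close>
  that contain it. This covers the bold complex, the quotient of the components inside \<open>B\<close>, and the
  components of the graph induced by \<open>S \<inter> A\<close>. All degrees are treated at once.
\<close>
definition face_sum :: "('a set \<Rightarrow> 'a set set) \<Rightarrow> ('a, 'k::field) chain \<Rightarrow> 'a set \<Rightarrow> 'a set \<Rightarrow> 'k" where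
  "face_sum X c S y = (\<Sum>x | x \<in> X S \<and> x \<subseteq> y. c (S, x))"

definition cube_diff ::
  "('a set \<Rightarrow> 'a set set) \<Rightarrow> ('a set \<Rightarrow> 'a set \<Rightarrow> bit) \<Rightarrow> ('a, 'k::field) chain \<Rightarrow> ('a, 'k) chain" where
  "cube_diff X s c = (\<lambda>(S, y). if y \<in> X S
     then \<Sum>v\<in>S. bit_sign (s (S - {v}) S) * face_sum X c (S - {v}) y else 0)"

definition supported_on :: "('a set \<Rightarrow> 'a set set) \<Rightarrow> ('a, 'k::field) chain \<Rightarrow> bool" where
  "supported_on X c \<longleftrightarrow> (\<forall>S x. x \<notin> X S \<longrightarrow> c (S, x) = 0)"

lemma face_sum_diff: "face_sum X (c - d) S y = face_sum X c S y - face_sum X d S y"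
  by (simp add: face_sum_def sum_subtractf)

lemma cube_diff_diff: "cube_diff X s (c - d) = cube_diff X s c - cube_diff X s d"
  by (rule ext) (auto simp: cube_diff_def face_sum_diff sum_subtractf right_diff_distrib)

lemma cube_diff_add: "cube_diff X s (c + d) = cube_diff X s c + cube_diff X s d"
  by (rule ext) (auto simp: cube_diff_def face_sum_def sum.distrib distrib_left)

lemma supported_on_cube_diff: "supported_on X (cube_diff X s c)"
  by (simp add: supported_on_def cube_diff_def)

text \<open>By induction on the set, because in characteristic 2 a sum that equals its negative need not vanish.\<close>
lemma sum_antisymmetric:
  fixes f :: "'a \<Rightarrow> 'a \<Rightarrow> 'k::ab_group_add"
  assumes "finite S" "\<And>v w. \<lbrakk>v \<in> S; w \<in> S; v \<noteq> w\<rbrakk> \<Longrightarrow> f v w = - f w v"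
  shows "(\<Sum>v\<in>S. \<Sum>w\<in>S - {v}. f v w) = 0"
  using assms
proof (induction S rule: finite_induct)
  case empty
  then show ?case by simp
next
  case (insert a S)
  have IH: "(\<Sum>v\<in>S. \<Sum>w\<in>S - {v}. f v w) = 0"
    using insert.prems by (intro insert.IH) blast
  have "(\<Sum>v\<in>S. \<Sum>w\<in>insert a S - {v}. f v w) = (\<Sum>v\<in>S. f v a + (\<Sum>w\<in>S - {v}. f v w))"
  proof (rule sum.cong)
    fix v assume "v \<in> S"
    then have "insert a S - {v} = insert a (S - {v})" using insert.hyps by blast
    then show "(\<Sum>w\<in>insert a S - {v}. f v w) = f v a + (\<Sum>w\<in>S - {v}. f v w)"
      using insert.hyps by simp
  qed simp
  also have "\<dots> = (\<Sum>v\<in>S. f v a)"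
    by (simp add: sum.distrib IH)
  also have "\<dots> = (\<Sum>v\<in>S. - f a v)"
  proof (rule sum.cong)
    fix v assume "v \<in> S"
    then show "f v a = - f a v" using insert.hyps by (intro insert.prems) auto
  qed simp
  finally show ?case
    using insert.hyps by (simp add: sum_negf)
qed

locale signed_cube =
  fixes V :: "'a set" and s :: "'a set \<Rightarrow> 'a set \<Rightarrow> bit"
  assumes finite_V: "finite V"
    and sign_square: "\<lbrakk>S \<subseteq> V; v \<in> V - S; w \<in> V - S; v \<noteq> w\<rbrakk> \<Longrightarrow>
      s S (insert v S) + s (insert v S) (insert w (insert v S))
      = s S (insert w S) + s (insert w S) (insert w (insert v S)) + 1"
begin

lemma bit_sign_square:
  assumes "S \<subseteq> V" "v \<in> S" "w \<in> V" "w \<notin> S"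
  shows "bit_sign (s (S - {v}) S) * bit_sign (s S (insert w S))
    = - (bit_sign (s (S - {v}) (insert w (S - {v})))
         * bit_sign (s (insert w (S - {v})) (insert w S)) :: 'k::field)"
proof -
  have ins: "insert v (S - {v}) = S" using assms(2) by blast
  have "S - {v} \<subseteq> V" "v \<in> V - (S - {v})" "w \<in> V - (S - {v})" "v \<noteq> w"
    using assms by auto
  from sign_square[OF this]
  have "s (S - {v}) S + s S (insert w S)
    = s (S - {v}) (insert w (S - {v})) + s (insert w (S - {v})) (insert w S) + 1"
    unfolding ins .
  then show ?thesis by (rule bit_sign_anticommute)
qed

text \<open>
  Each generator has exactly one image over every larger set, so removing two vertices in either
  order gives the same inner sum; the signs of the two orders are opposite.
\<close>
lemma cube_diff_cube_diff:
  fixes c :: "('a, 'k::field) chain"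
  assumes in_V: "\<And>S. X S \<noteq> {} \<Longrightarrow> S \<subseteq> V"
    and fin: "\<And>S. finite (X S)"
    and up: "\<And>S S' x. \<lbrakk>S \<subseteq> S'; S' \<subseteq> V; x \<in> X S\<rbrakk> \<Longrightarrow> \<exists>y\<in>X S'. x \<subseteq> y"
    and up_unique: "\<And>S S' x y z. \<lbrakk>S \<subseteq> S'; x \<in> X S; y \<in> X S'; z \<in> X S'; x \<subseteq> y; x \<subseteq> z\<rbrakk> \<Longrightarrow> y = z"
  shows "cube_diff X s (cube_diff X s c) = 0"
proof -
  have "cube_diff X s (cube_diff X s c) (S, y) = 0" if y: "y \<in> X S" for S y
  proof -
    have S: "S \<subseteq> V" using in_V y by blast
    define f where "f v w = bit_sign (s (S - {v}) S) * bit_sign (s (S - {v} - {w}) (S - {v}))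
      * face_sum X c (S - {v} - {w}) y" for v w
    \<comment> \<open>a generator over \<open>S''\<close> inside \<open>y\<close> factors through exactly one generator over \<open>S'\<close>\<close>
    have two: "(\<Sum>x | x \<in> X S' \<and> x \<subseteq> y. face_sum X c S'' x) = face_sum X c S'' y"
      if sub: "S'' \<subseteq> S'" "S' \<subseteq> S" for S' S''
    proof -
      have "{z \<in> X S''. z \<subseteq> y} = (\<Union>x\<in>{x \<in> X S'. x \<subseteq> y}. {z \<in> X S''. z \<subseteq> x})"
      proof (intro equalityI subsetI)
        fix z assume z: "z \<in> {z \<in> X S''. z \<subseteq> y}"
        obtain x where x: "x \<in> X S'" "z \<subseteq> x" using up[of S'' S' z] sub S z by blast
        obtain y' where y': "y' \<in> X S" "x \<subseteq> y'" using up[of S' S x] sub S x by blast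
        have "z \<subseteq> y'" "z \<subseteq> y" "z \<in> X S''" "S'' \<subseteq> S" using x y' z sub by auto
        then have "y' = y" using up_unique y y'(1) by blast
        with x y' z show "z \<in> (\<Union>x\<in>{x \<in> X S'. x \<subseteq> y}. {z \<in> X S''. z \<subseteq> x})" by blast
      qed blast
      moreover have "{z \<in> X S''. z \<subseteq> x} \<inter> {z \<in> X S''. z \<subseteq> x'} = {}"
        if "x \<in> X S'" "x' \<in> X S'" "x \<noteq> x'" for x x'
        using up_unique[OF sub(1)] that by blast
      ultimately show ?thesis
        unfolding face_sum_def using fin
        by (subst sum.UNION_disjoint[symmetric]) auto
    qed
    have "cube_diff X s (cube_diff X s c) (S, y) = (\<Sum>v\<in>S. \<Sum>w\<in>S - {v}. f v w)"
    proof -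
      have "face_sum X (cube_diff X s c) (S - {v}) y
        = (\<Sum>w\<in>S - {v}. bit_sign (s (S - {v} - {w}) (S - {v})) * face_sum X c (S - {v} - {w}) y)" for v
      proof -
        have "face_sum X (cube_diff X s c) (S - {v}) y
          = (\<Sum>x | x \<in> X (S - {v}) \<and> x \<subseteq> y. \<Sum>w\<in>S - {v}.
              bit_sign (s (S - {v} - {w}) (S - {v})) * face_sum X c (S - {v} - {w}) x)"
          unfolding face_sum_def[of X "cube_diff X s c"] by (intro sum.cong) (auto simp: cube_diff_def)
        also have "\<dots> = (\<Sum>w\<in>S - {v}. bit_sign (s (S - {v} - {w}) (S - {v}))
            * (\<Sum>x | x \<in> X (S - {v}) \<and> x \<subseteq> y. face_sum X c (S - {v} - {w}) x))"
          by (subst sum.swap) (simp add: sum_distrib_left)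
        finally show ?thesis by (simp add: two Diff_subset)
      qed
      then show ?thesis
        using y by (simp add: cube_diff_def[of X s "cube_diff X s c"] f_def sum_distrib_left mult.assoc)
    qed
    also have "\<dots> = 0"
    proof (rule sum_antisymmetric)
      show "finite S" using S finite_V finite_subset by blast
      fix v w assume vw: "v \<in> S" "w \<in> S" "v \<noteq> w"
      have sw: "S - {v} - {w} = S - {w} - {v}" "insert w (S - {w} - {v}) = S - {v}" "insert w (S - {w}) = S" "insert w S = S"
        using vw by auto
      have "bit_sign (s (S - {w} - {v}) (S - {w})) * bit_sign (s (S - {w}) S)
        = - (bit_sign (s (S - {w} - {v}) (S - {v})) * bit_sign (s (S - {v}) S) :: 'k)"
        using bit_sign_square[of "S - {w}" v w] S vw by (simp add: sw subset_iff)
      then show "f v w = - f w v"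
        unfolding f_def sw(1) by (simp add: mult.commute[of "bit_sign (s (S - {v}) S)"]
            mult.commute[of "bit_sign (s (S - {w}) S)"])
    qed
    finally show ?thesis .
  qed
  then show ?thesis by (intro ext) (auto simp: cube_diff_def)
qed

text \<open>The contracting homotopy: it removes \<open>t\<close> from \<open>S\<close>, written in terms of coefficients.\<close>
definition toggle :: "'a \<Rightarrow> ('a set \<Rightarrow> 'a set set) \<Rightarrow> ('a, 'k::field) chain \<Rightarrow> ('a, 'k) chain" where
  "toggle t X c = (\<lambda>(S, x). if x \<in> X S \<and> t \<notin> S
     then bit_sign (s S (insert t S)) * c (insert t S, x) else 0)"

lemma supported_on_toggle: "supported_on X (toggle t X c)"
  by (simp add: supported_on_def toggle_def)

text \<open>
  If \<open>X S\<close> does not depend on whether \<open>t \<in> S\<close>, the complex is the cone of an identity map, and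
  toggling \<open>t\<close> gives a primitive of every cycle. The antichain condition makes the differential
  in direction \<open>t\<close> this identity.
\<close>
lemma cube_diff_toggle:
  fixes c :: "('a, 'k::field) chain"
  assumes t: "t \<in> V"
    and in_V: "\<And>S. X S \<noteq> {} \<Longrightarrow> S \<subseteq> V"
    and indep: "\<And>S. S \<subseteq> V \<Longrightarrow> X (insert t S) = X S"
    and antichain: "\<And>S x y. \<lbrakk>x \<in> X S; y \<in> X S; x \<subseteq> y\<rbrakk> \<Longrightarrow> x = y"
    and supp: "supported_on X c" and cycle: "cube_diff X s c = 0"
  shows "cube_diff X s (toggle t X c) = c"
proof -
  have "cube_diff X s (toggle t X c) (S, y) = c (S, y)" if y: "y \<in> X S" for S y
  proof -
    have S: "S \<subseteq> V" using in_V y by blast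
    then have finS: "finite S" using finite_V finite_subset by blast
    have single: "{x. x \<in> X S \<and> x \<subseteq> y} = {y}" using antichain y by blast
    show ?thesis
    proof (cases "t \<in> S")
      \<comment> \<open>only the removal of \<open>t\<close> itself reaches the support of the homotopy\<close>
      case True
      have ins: "insert t (S - {t}) = S" "insert t S = S" using True by blast+
      have X: "X (S - {t}) = X S" using indep[of "S - {t}"] S ins by auto
      have "cube_diff X s (toggle t X c) (S, y)
        = (\<Sum>v\<in>S. bit_sign (s (S - {v}) S) * face_sum X (toggle t X c) (S - {v}) y)"
        using y by (simp add: cube_diff_def)
      also have "\<dots> = (\<Sum>v\<in>S. if v = t
          then bit_sign (s (S - {t}) S) * face_sum X (toggle t X c) (S - {t}) y else 0)"
        using True by (intro sum.cong) (auto simp: face_sum_def toggle_def)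
      also have "\<dots> = bit_sign (s (S - {t}) S) * face_sum X (toggle t X c) (S - {t}) y"
        using True finS by (simp add: sum.delta)
      also have "face_sum X (toggle t X c) (S - {t}) y = bit_sign (s (S - {t}) S) * c (S, y)"
        using y by (simp add: face_sum_def toggle_def X ins single)
      finally show ?thesis by simp
    next
      case False
      \<comment> \<open>read \<open>c (S, y)\<close> off the cycle condition at \<open>(insert t S, y)\<close>\<close>
      define p :: 'k where "p = bit_sign (s S (insert t S))"
      have pp: "p * p = 1" by (simp add: p_def)
      let ?R = "\<lambda>v. bit_sign (s (insert t (S - {v})) (insert t S)) * face_sum X c (insert t (S - {v})) y"
      have y': "y \<in> X (insert t S)" using y indep S by simp
      have "0 = cube_diff X s c (insert t S, y)" by (simp add: cycle)
      also have "\<dots> = p * face_sum X c S y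
          + (\<Sum>v\<in>S. bit_sign (s (insert t S - {v}) (insert t S)) * face_sum X c (insert t S - {v}) y)"
        using y' False finS by (simp add: cube_diff_def p_def)
      also have "(\<Sum>v\<in>S. bit_sign (s (insert t S - {v}) (insert t S)) * face_sum X c (insert t S - {v}) y)
          = (\<Sum>v\<in>S. ?R v)"
      proof (rule sum.cong)
        fix v assume "v \<in> S"
        then have "insert t S - {v} = insert t (S - {v})" using False by blast
        then show "bit_sign (s (insert t S - {v}) (insert t S)) * face_sum X c (insert t S - {v}) y = ?R v"
          by simp
      qed simp
      also have "face_sum X c S y = c (S, y)" by (simp add: face_sum_def single)
      finally have "p * c (S, y) = - (\<Sum>v\<in>S. ?R v)" by (simp add: eq_neg_iff_add_eq_0)
      then have "p * (p * c (S, y)) = p * - (\<Sum>v\<in>S. ?R v)" by simp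
      then have c: "c (S, y) = (\<Sum>v\<in>S. - (p * ?R v))"
        using pp by (simp add: mult.assoc[symmetric] sum_distrib_left sum_negf)
      have "bit_sign (s (S - {v}) S) * face_sum X (toggle t X c) (S - {v}) y = - (p * ?R v)"
        if v: "v \<in> S" for v
      proof -
        define q :: 'k where "q = bit_sign (s (S - {v}) S)"
        define r :: 'k where "r = bit_sign (s (S - {v}) (insert t (S - {v})))"
        define u :: 'k where "u = bit_sign (s (insert t (S - {v})) (insert t S))"
        have "q * p = - (r * u)"
          using bit_sign_square[of S v t] S v t False by (simp add: p_def q_def r_def u_def)
        moreover have "r * r = 1" "p * p = 1" by (simp_all add: r_def p_def)
        ultimately have qr: "q * r = - (p * u)"
          by algebra
        have "X (S - {v}) = X (insert t (S - {v}))" using indep[of "S - {v}"] S by blast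
        then have "face_sum X (toggle t X c) (S - {v}) y = r * face_sum X c (insert t (S - {v})) y"
          using False unfolding face_sum_def sum_distrib_left
          by (intro sum.cong) (auto simp: toggle_def r_def)
        then have "q * face_sum X (toggle t X c) (S - {v}) y = (q * r) * face_sum X c (insert t (S - {v})) y"
          by simp
        then show ?thesis unfolding q_def[symmetric] u_def[symmetric] qr by simp
      qed
      then show ?thesis using y c by (simp add: cube_diff_def)
    qed
  qed
  moreover have "c (S, y) = 0" "cube_diff X s (toggle t X c) (S, y) = 0" if "y \<notin> X S" for S y
    using that supp by (auto simp: supported_on_def cube_diff_def)
  ultimately show ?thesis by (intro ext) (metis surj_pair)
qed

end

section \<open>Components of induced subgraphs\<close>

text \<open>
  The components of the graph induced by \<open>S\<close> are the minimal nonempty unions of components. A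
  union of components is a subset that no edge within \<open>S\<close> leaves, a condition on single edges that
  lets all later arguments avoid paths.
\<close>
definition closed_in :: "'a pair_pre_digraph \<Rightarrow> 'a set \<Rightarrow> 'a set \<Rightarrow> bool" where
  "closed_in G S z \<longleftrightarrow> z \<subseteq> S \<and> (\<forall>u\<in>z. \<forall>w\<in>S. (u, w) \<in> parcs G \<longrightarrow> w \<in> z)"

lemma in_components_iff:
  assumes sym: "sym (parcs G)"
  shows "x \<in> components G S \<longleftrightarrow>
    x \<noteq> {} \<and> closed_in G S x \<and> (\<forall>z. z \<subseteq> x \<and> z \<noteq> {} \<and> closed_in G S z \<longrightarrow> z = x)"
proof -
  let ?H = "with_proj G \<restriction> S"
  have ends: "u \<rightarrow>\<^bsub>?H\<^esub> v \<longleftrightarrow> u \<in> S \<and> v \<in> S \<and> (u, v) \<in> parcs G" for u v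
    by (auto simp: arcs_ends_def arc_to_ends_def)
  interpret H: wf_digraph ?H by unfold_locales auto
  have "symmetric ?H" using sym ends unfolding symmetric_def sym_def by blast
  then have reach_sym: "v \<rightarrow>\<^sup>*\<^bsub>?H\<^esub> u" if "u \<rightarrow>\<^sup>*\<^bsub>?H\<^esub> v" for u v
    using that by (rule symmetric_reachable)
  have in_closed: "v \<in> z" if "u \<rightarrow>\<^sup>*\<^bsub>?H\<^esub> v" "u \<in> z" "closed_in G S z" for u v z
    using that by (induction rule: H.reachable_induct) (auto simp: ends closed_in_def)
  have closed_reach: "closed_in G S {v. u \<rightarrow>\<^sup>*\<^bsub>?H\<^esub> v}" for u
    unfolding closed_in_def
  proof (intro conjI ballI impI subsetI)
    fix v assume "v \<in> {v. u \<rightarrow>\<^sup>*\<^bsub>?H\<^esub> v}"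
    then have v: "u \<rightarrow>\<^sup>*\<^bsub>?H\<^esub> v" by simp
    then show vS: "v \<in> S" using H.reachable_in_verts(2) by fastforce
    fix w assume "w \<in> S" "(v, w) \<in> parcs G"
    then have "v \<rightarrow>\<^bsub>?H\<^esub> w" using vS ends by blast
    with v show "w \<in> {v. u \<rightarrow>\<^sup>*\<^bsub>?H\<^esub> v}" using H.reachable_adj_trans by blast
  qed
  have mem: "x \<in> components G S \<longleftrightarrow> x \<noteq> {} \<and> (\<forall>u\<in>x. \<forall>v. v \<in> x \<longleftrightarrow> u \<rightarrow>\<^sup>*\<^bsub>?H\<^esub> v)"
    unfolding components_def H.in_sccs_verts_conv_reachable using reach_sym by blast
  show ?thesis
  proof
    assume x: "x \<in> components G S"
    then obtain u where u: "u \<in> x" unfolding mem by blast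
    have x_eq: "x = {v. w \<rightarrow>\<^sup>*\<^bsub>?H\<^esub> v}" if "w \<in> x" for w
      using x that unfolding mem by blast
    have "z = x" if z: "z \<subseteq> x" "z \<noteq> {}" "closed_in G S z" for z
    proof -
      obtain w where w: "w \<in> z" using z by blast
      then have "v \<in> z" if "v \<in> x" for v
        using in_closed[of w v z] x_eq[of w] that z by auto
      then show ?thesis using z by blast
    qed
    moreover have "closed_in G S x" using closed_reach[of u] x_eq[OF u] by simp
    ultimately show "x \<noteq> {} \<and> closed_in G S x \<and> (\<forall>z. z \<subseteq> x \<and> z \<noteq> {} \<and> closed_in G S z \<longrightarrow> z = x)"
      using u by auto
  next
    assume x: "x \<noteq> {} \<and> closed_in G S x \<and> (\<forall>z. z \<subseteq> x \<and> z \<noteq> {} \<and> closed_in G S z \<longrightarrow> z = x)"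
    have "{v. u \<rightarrow>\<^sup>*\<^bsub>?H\<^esub> v} = x" if u: "u \<in> x" for u
    proof -
      have "u \<in> S" using u x by (auto simp: closed_in_def)
      then have "u \<in> {v. u \<rightarrow>\<^sup>*\<^bsub>?H\<^esub> v}" by (simp add: H.reachable_refl)
      moreover have "{v. u \<rightarrow>\<^sup>*\<^bsub>?H\<^esub> v} \<subseteq> x" using in_closed u x by blast
      ultimately show ?thesis using x closed_reach[of u] by auto
    qed
    then show "x \<in> components G S" unfolding mem using x by auto
  qed
qed

lemma componentD:
  assumes "sym (parcs G)" and "x \<in> components G S"
  shows "x \<noteq> {}" "x \<subseteq> S" "closed_in G S x"
    "\<And>z. \<lbrakk>z \<subseteq> x; z \<noteq> {}; closed_in G S z\<rbrakk> \<Longrightarrow> z = x"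
proof -
  note x = assms(2)[unfolded in_components_iff[OF assms(1)]]
  show "x \<noteq> {}" "closed_in G S x" using x by simp_all
  then show "x \<subseteq> S" unfolding closed_in_def by simp
  show "z = x" if "z \<subseteq> x" "z \<noteq> {}" "closed_in G S z" for z
    using x that by simp
qed

lemma component_subset:
  assumes sym: "sym (parcs G)" and "S \<subseteq> S'" "x \<in> components G S" "y \<in> components G S'" "x \<inter> y \<noteq> {}"
  shows "x \<subseteq> y"
proof -
  have "closed_in G S x" "closed_in G S' y" using componentD(3)[OF sym] assms by auto
  then have "closed_in G S (x \<inter> y)"
    using \<open>S \<subseteq> S'\<close> unfolding closed_in_def by blast
  then have "x \<inter> y = x" using componentD(4)[OF sym assms(3), of "x \<inter> y"] assms(5) by simp
  then show ?thesis by blast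
qed

text \<open>
  The component of \<open>v\<close> is the least closed set containing \<open>v\<close>. It is minimal: a closed part \<open>z\<close>
  without \<open>v\<close> could be removed from it, as symmetry of the arcs makes complements of closed sets
  closed.
\<close>
lemma component_of_vertex:
  assumes sym: "sym (parcs G)" and v: "v \<in> S"
  shows "\<exists>x \<in> components G S. v \<in> x"
proof -
  define x where "x = \<Inter>{z. closed_in G S z \<and> v \<in> z}"
  have least: "x \<subseteq> z" if "closed_in G S z" "v \<in> z" for z
    unfolding x_def using that by blast
  have vx: "v \<in> x" unfolding x_def by blast
  have "closed_in G S S" by (simp add: closed_in_def)
  then have xS: "x \<subseteq> S" using least v by blast
  have step: "w \<in> x" if "u \<in> x" "w \<in> S" "(u, w) \<in> parcs G" for u w
    unfolding x_def
  proof (intro InterI, clarify)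
    fix z assume "closed_in G S z" "v \<in> z"
    then show "w \<in> z" using least[of z] that unfolding closed_in_def by blast
  qed
  have "z = x" if z: "z \<subseteq> x" "z \<noteq> {}" "closed_in G S z" for z
  proof (cases "v \<in> z")
    case True
    then show ?thesis using z least by blast
  next
    case False
    have "closed_in G S (x - z)"
      unfolding closed_in_def
    proof (intro conjI ballI impI)
      show "x - z \<subseteq> S" using xS by blast
      fix u w assume u: "u \<in> x - z" and w: "w \<in> S" and uw: "(u, w) \<in> parcs G"
      have "(w, u) \<in> parcs G" using sym uw by (rule symD)
      then have "w \<notin> z" using z(3) u xS unfolding closed_in_def by blast
      then show "w \<in> x - z" using step u w uw by blast
    qed
    then have "x \<subseteq> x - z" using False vx least by blast
    then show ?thesis using z by blast
  qed
  moreover have "closed_in G S x" unfolding closed_in_def using xS step by blast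
  ultimately have "x \<in> components G S"
    unfolding in_components_iff[OF sym] using vx by auto
  then show ?thesis using vx by blast
qed

lemma component_superset_exists:
  assumes sym: "sym (parcs G)" and "S \<subseteq> S'" "x \<in> components G S"
  shows "\<exists>y \<in> components G S'. x \<subseteq> y"
proof -
  obtain v where v: "v \<in> x" "v \<in> S'"
    using componentD(1,2)[OF sym assms(3)] assms(2) by blast
  then obtain y where "y \<in> components G S'" "v \<in> y"
    using component_of_vertex[OF sym] by blast
  then show ?thesis using component_subset[OF sym assms(2,3)] v by blast
qed

lemma components_eq:
  assumes sym: "sym (parcs G)" and "x \<in> components G S" "y \<in> components G S" "x \<inter> y \<noteq> {}"
  shows "x = y"
  using component_subset[OF sym order_refl assms(2,3)] component_subset[OF sym order_refl assms(3,2)] assms(4)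
  by blast

section \<open>The bold complex as a signed cube\<close>

definition bold_cube :: "'a pair_pre_digraph \<Rightarrow> 'a set \<Rightarrow> 'a set set" where
  "bold_cube G S = (if S \<subseteq> pverts G then components G S else {})"

lemma in_bold_gens_iff: "(S, x) \<in> bold_gens G i \<longleftrightarrow> x \<in> bold_cube G S \<and> int (card S) = i"
  by (auto simp: bold_gens_def bold_cube_def)

lemma bold_cube_subset:
  assumes "sym (parcs G)" "x \<in> bold_cube G S"
  shows "S \<subseteq> pverts G" "x \<subseteq> S" "x \<noteq> {}"
  using assms(2) componentD(1,2)[OF assms(1), of x S] by (simp_all add: bold_cube_def split: if_splits)

lemma finite_bold_cube:
  assumes "finite (pverts G)" "sym (parcs G)"
  shows "finite (bold_cube G S)"
proof (rule finite_subset)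
  show "bold_cube G S \<subseteq> Pow (pverts G)" using bold_cube_subset[OF assms(2)] by blast
qed (simp add: assms(1))

lemma signed_cube_of_sign_assignment:
  assumes "finite (pverts G)" "sign_assignment G s"
  shows "signed_cube (pverts G) s"
proof
  fix S v w assume S: "S \<subseteq> pverts G" "v \<in> pverts G - S" "w \<in> pverts G - S" "v \<noteq> w"
  have "cover G S (insert v S)" "cover G S (insert w S)"
    using S by (auto simp: cover_def)
  moreover have "cover G (insert v S) (insert w (insert v S))"
    unfolding cover_def using S by (intro conjI bexI[of _ w]) auto
  moreover have "cover G (insert w S) (insert w (insert v S))"
    unfolding cover_def using S by (intro conjI bexI[of _ v]) auto
  moreover have "insert v S \<noteq> insert w S" using S by blast
  ultimately show "s S (insert v S) + s (insert v S) (insert w (insert v S))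
      = s S (insert w S) + s (insert w S) (insert w (insert v S)) + 1"
    using assms(2) unfolding sign_assignment_def by blast
qed (fact assms(1))

text \<open>
  The differential of the bold complex sums over all generators; only those over \<open>S' - {v}\<close> with
  \<open>v \<in> S'\<close> contribute to a coefficient over \<open>S'\<close>.
\<close>
lemma bold_diff_eq_cube_diff:
  fixes c :: "('a, 'k::field) chain"
  assumes fin: "finite (pverts G)" and sym: "sym (parcs G)" and c: "c \<in> bold_chains G i"
  shows "bold_diff G s i c = cube_diff (bold_cube G) s c"
proof (rule ext, clarify)
  fix S' y
  show "bold_diff G s i c (S', y) = cube_diff (bold_cube G) s c (S', y)"
  proof (cases "y \<in> bold_cube G S'")
    case False
    have "bold_diff_gen G s g (S', y) = (0::'k)" for g
      using False by (cases g) (auto simp: bold_diff_gen_def bold_cube_def cover_def split: if_splits)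
    then show ?thesis using False by (simp add: bold_diff_def cube_diff_def)
  next
    case True
    then have S': "S' \<subseteq> pverts G" and y: "y \<in> components G S'"
      using bold_cube_subset(1)[OF sym True] True by (simp_all add: bold_cube_def)
    have finS': "finite S'" using S' fin finite_subset by blast
    define F where "F = (SIGMA v:S'. {x \<in> bold_cube G (S' - {v}). x \<subseteq> y})"
    let ?f = "\<lambda>(v, x). (S' - {v}, x)"
    have finx: "finite {x \<in> bold_cube G (S' - {v}). x \<subseteq> y}" for v
      using finite_bold_cube[OF fin sym, of "S' - {v}"] by (rule rev_finite_subset) blast
    then have finF: "finite F" unfolding F_def using finS' by blast
    have inj: "inj_on ?f F"
    proof (rule inj_onI)
      fix h h' assume h: "h \<in> F" "h' \<in> F" "?f h = ?f h'"
      obtain v x v' x' where hh: "h = (v, x)" "h' = (v', x')" by (cases h; cases h')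
      then have "v \<in> S'" "v' \<in> S'" "S' - {v} = S' - {v'}" "x = x'" using h by (auto simp: F_def)
      then show "h = h'" using hh by blast
    qed
    have "bold_gens G i \<subseteq> Pow (pverts G) \<times> Pow (pverts G)"
    proof (rule subrelI)
      fix S x assume "(S, x) \<in> bold_gens G i"
      then have "x \<in> bold_cube G S" by (simp add: in_bold_gens_iff)
      then show "(S, x) \<in> Pow (pverts G) \<times> Pow (pverts G)"
        using bold_cube_subset[OF sym] by blast
    qed
    then have fing: "finite (bold_gens G i)" by (rule finite_subset) (simp add: fin)
    have zero: "bold_diff_gen G s g (S', y) = (0::'k)" if "g \<in> bold_gens G i - ?f ` F" for g
    proof (rule ccontr)
      assume nz: "bold_diff_gen G s g (S', y) \<noteq> (0::'k)"
      obtain S x where g: "g = (S, x)" by (cases g)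
      from nz g have "cover G S S'" "x \<subseteq> y" by (auto simp: bold_diff_gen_def split: if_splits)
      then obtain v where v: "v \<notin> S" "S' = insert v S" by (auto simp: cover_def)
      then have "S = S' - {v}" by blast
      then have "g = ?f (v, x)" "(v, x) \<in> F"
        using v \<open>x \<subseteq> y\<close> g that by (auto simp: F_def in_bold_gens_iff)
      then show False using that by blast
    qed
    have "bold_diff G s i c (S', y) = (\<Sum>g\<in>?f ` F. c g * bold_diff_gen G s g (S', y))"
      unfolding bold_diff_def using fing finF zero c
      by (intro sum.mono_neutral_cong) (auto simp: bold_chains_def)
    also have "\<dots> = (\<Sum>h\<in>F. c (?f h) * bold_diff_gen G s (?f h) (S', y))"
      using inj by (simp add: sum.reindex)
    also have "\<dots> = (\<Sum>(v, x)\<in>F. bit_sign (s (S' - {v}) S') * c (S' - {v}, x))"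
    proof (rule sum.cong, simp, clarify)
      fix v x assume "(v, x) \<in> F"
      then have "cover G (S' - {v}) S'" "x \<subseteq> y"
        using S' by (auto simp: F_def cover_def)
      then show "c (S' - {v}, x) * bold_diff_gen G s (S' - {v}, x) (S', y)
          = bit_sign (s (S' - {v}) S') * c (S' - {v}, x)"
        using y by (simp add: bold_diff_gen_def bit_sign_def)
    qed
    also have "\<dots> = (\<Sum>v\<in>S'. \<Sum>x | x \<in> bold_cube G (S' - {v}) \<and> x \<subseteq> y.
        bit_sign (s (S' - {v}) S') * c (S' - {v}, x))"
      unfolding F_def using finS' finx by (subst sum.Sigma) auto
    also have "\<dots> = cube_diff (bold_cube G) s c (S', y)"
      using True by (simp add: cube_diff_def face_sum_def sum_distrib_left)
    finally show ?thesis .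
  qed
qed

section \<open>Graphs split by a bridge\<close>

text \<open>
  The only possible edge between the parts \<open>A\<close> and \<open>B\<close> joins \<open>p\<close> to \<open>q\<close>. The vertices \<open>a\<close> and \<open>b\<close>
  are the ones to be toggled; \<open>b\<close> may be an end of the bridge, but \<open>a\<close> may not.
\<close>
locale bridge_split =
  fixes G :: "'a pair_pre_digraph" and A B :: "'a set" and p q a b :: 'a
  assumes finite_verts: "finite (pverts G)"
    and sym_arcs: "sym (parcs G)"
    and verts_eq: "pverts G = A \<union> B" and disjoint: "A \<inter> B = {}"
    and bridge: "\<lbrakk>u \<in> A; w \<in> B; (u, w) \<in> parcs G\<rbrakk> \<Longrightarrow> u = p \<and> w = q"
    and a: "a \<in> A" "a \<noteq> p" and b: "b \<in> B"
begin

lemma bridge_reversed: "\<lbrakk>u \<in> A; w \<in> B; (w, u) \<in> parcs G\<rbrakk> \<Longrightarrow> u = p \<and> w = q"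
  using bridge symD[OF sym_arcs] by blast

text \<open>No edge joins \<open>a\<close> to \<open>B\<close>, so a subset of \<open>B\<close> is closed with \<open>a\<close> present iff it is without.\<close>
lemma components_insert_a:
  assumes "x \<subseteq> B"
  shows "x \<in> components G (insert a S) \<longleftrightarrow> x \<in> components G S"
proof -
  have "closed_in G (insert a S) z \<longleftrightarrow> closed_in G S z" if "z \<subseteq> B" for z
    using that a disjoint bridge_reversed[OF a(1)] unfolding closed_in_def by blast
  then have "closed_in G (insert a S) z \<longleftrightarrow> closed_in G S z" if "z \<subseteq> x" for z
    using that assms by blast
  then show ?thesis unfolding in_components_iff[OF sym_arcs] by (metis order_refl)
qed

text \<open>
  A closed part \<open>z\<close> of \<open>y \<inter> A\<close> extends to a closed part of \<open>y\<close>: it is closed already if it misses the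
  end \<open>p\<close> of the bridge, and otherwise all of \<open>y \<inter> B\<close> is added. As \<open>y\<close> is minimal, the extension is
  \<open>y\<close> and \<open>z = y \<inter> A\<close>.
\<close>
lemma component_inter_A:
  assumes S: "S \<subseteq> pverts G" and y: "y \<in> components G S" and ne: "y \<inter> A \<noteq> {}"
  shows "y \<inter> A \<in> components G (S \<inter> A)"
proof -
  have cl: "closed_in G S y" and min: "\<And>z. \<lbrakk>z \<subseteq> y; z \<noteq> {}; closed_in G S z\<rbrakk> \<Longrightarrow> z = y"
    using componentD(3,4)[OF sym_arcs y] by blast+
  have "closed_in G (S \<inter> A) (y \<inter> A)" using cl by (auto simp: closed_in_def)
  moreover have "z = y \<inter> A" if z: "z \<subseteq> y \<inter> A" "z \<noteq> {}" "closed_in G (S \<inter> A) z" for z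
  proof (cases "p \<in> z")
    case False
    have "closed_in G S z"
      unfolding closed_in_def
    proof (intro conjI ballI impI)
      show "z \<subseteq> S" using z by (auto simp: closed_in_def)
      fix u w assume uw: "u \<in> z" "w \<in> S" "(u, w) \<in> parcs G"
      then have "w \<in> A" using bridge[of u w] False z S verts_eq by blast
      then show "w \<in> z" using z(3) uw by (auto simp: closed_in_def)
    qed
    then have "z = y" using min z by blast
    then show ?thesis using z by blast
  next
    case True
    have "closed_in G S (z \<union> (y \<inter> B))"
      unfolding closed_in_def
    proof (intro conjI ballI impI)
      show "z \<union> (y \<inter> B) \<subseteq> S" using z cl by (auto simp: closed_in_def)
      fix u w assume u: "u \<in> z \<union> (y \<inter> B)" and w: "w \<in> S" and uw: "(u, w) \<in> parcs G"
      have wy: "w \<in> y" using u w uw z cl unfolding closed_in_def by blast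
      show "w \<in> z \<union> (y \<inter> B)"
      proof (cases "w \<in> B")
        case False
        then have wA: "w \<in> A" using w S verts_eq by blast
        show ?thesis
        proof (cases "u \<in> z")
          case True
          then show ?thesis using z(3) w wA uw by (auto simp: closed_in_def)
        next
          case False
          then have "w = p" using u wA uw bridge_reversed by blast
          then show ?thesis using True by blast
        qed
      qed (use wy in blast)
    qed
    then have "z \<union> (y \<inter> B) = y" using min[of "z \<union> (y \<inter> B)"] z by blast
    then show ?thesis using z disjoint by blast
  qed
  ultimately show ?thesis using ne unfolding in_components_iff[OF sym_arcs] by simp
qed

lemma component_of_inter_A:
  assumes S: "S \<subseteq> pverts G" and z: "z \<in> components G (S \<inter> A)"
  obtains y where "y \<in> components G S" "y \<inter> A = z"
proof -
  obtain v where v: "v \<in> z" "v \<in> S" "v \<in> A"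
    using componentD(1,2)[OF sym_arcs z] by blast
  then obtain y where y: "y \<in> components G S" "v \<in> y"
    using component_of_vertex[OF sym_arcs] by blast
  have "y \<inter> A \<in> components G (S \<inter> A)"
    using component_inter_A[OF S y(1)] v y(2) by blast
  then have "y \<inter> A = z"
    using components_eq[OF sym_arcs _ z] v y(2) by blast
  then show ?thesis using y that by blast
qed

lemma subset_iff_inter_A_subset:
  assumes "S \<subseteq> S'" "x \<in> components G S" "y \<in> components G S'" "x \<inter> A \<noteq> {}"
  shows "x \<inter> A \<subseteq> y \<inter> A \<longleftrightarrow> x \<subseteq> y"
proof
  assume "x \<inter> A \<subseteq> y \<inter> A"
  then have "x \<inter> y \<noteq> {}" using assms(4) by blast
  then show "x \<subseteq> y" by (rule component_subset[OF sym_arcs assms(1-3)])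
qed blast

text \<open>
  \<open>cube_A\<close> is the subcomplex of the components meeting \<open>A\<close>, with each component replaced by
  its intersection with \<open>A\<close>; \<open>cube_B\<close> is the quotient by this subcomplex.
\<close>
definition cube_A :: "'a set \<Rightarrow> 'a set set" where
  "cube_A S = (if S \<subseteq> pverts G then components G (S \<inter> A) else {})"

definition cube_B :: "'a set \<Rightarrow> 'a set set" where
  "cube_B S = {x \<in> bold_cube G S. x \<subseteq> B}"

text \<open>The inclusion of the subcomplex \<open>cube_A\<close> into the bold complex.\<close>
definition include_A :: "('a, 'k::field) chain \<Rightarrow> ('a, 'k) chain" where
  "include_A e = (\<lambda>(S, y). if y \<in> bold_cube G S \<and> y \<inter> A \<noteq> {} then e (S, y \<inter> A) else 0)"

lemma face_sum_include_A:
  assumes "S \<subseteq> S'" "y \<in> bold_cube G S'"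
  shows "face_sum (bold_cube G) (include_A e) S y = face_sum cube_A e S (y \<inter> A)"
proof -
  have S': "S' \<subseteq> pverts G" and y: "y \<in> components G S'"
    using assms by (auto simp: bold_cube_def split: if_splits)
  then have S: "S \<subseteq> pverts G" using assms by blast
  let ?M = "{x \<in> components G S. x \<subseteq> y \<and> x \<inter> A \<noteq> {}}"
  have bij: "bij_betw (\<lambda>x. x \<inter> A) ?M {z. z \<in> components G (S \<inter> A) \<and> z \<subseteq> y \<inter> A}"
    unfolding bij_betw_def
  proof
    show "inj_on (\<lambda>x. x \<inter> A) ?M"
      using components_eq[OF sym_arcs] by (auto simp: inj_on_def) blast+
    show "(\<lambda>x. x \<inter> A) ` ?M = {z. z \<in> components G (S \<inter> A) \<and> z \<subseteq> y \<inter> A}"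
    proof (intro equalityI subsetI)
      fix z assume z: "z \<in> {z. z \<in> components G (S \<inter> A) \<and> z \<subseteq> y \<inter> A}"
      then obtain x where x: "x \<in> components G S" "x \<inter> A = z"
        using component_of_inter_A[OF S] by blast
      moreover have "z \<noteq> {}" using z componentD(1)[OF sym_arcs] by blast
      moreover have "x \<subseteq> y"
        using subset_iff_inter_A_subset[OF assms(1) x(1) y] x(2) z \<open>z \<noteq> {}\<close> by simp
      ultimately show "z \<in> (\<lambda>x. x \<inter> A) ` ?M" by blast
    qed (use component_inter_A[OF S] in auto)
  qed
  have "(\<Sum>x\<in>?M. e (S, x \<inter> A)) = face_sum cube_A e S (y \<inter> A)"
    using sum.reindex_bij_betw[OF bij, of "\<lambda>z. e (S, z)"] S by (simp add: face_sum_def cube_A_def)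
  moreover have "face_sum (bold_cube G) (include_A e) S y = (\<Sum>x\<in>?M. e (S, x \<inter> A))"
  proof -
    have "finite (components G S)"
      using finite_bold_cube[OF finite_verts sym_arcs, of S] S by (simp add: bold_cube_def)
    then show ?thesis
      unfolding face_sum_def include_A_def bold_cube_def using S
      by (intro sum.mono_neutral_cong_right) auto
  qed
  ultimately show ?thesis by simp
qed

lemma cube_diff_include_A:
  "cube_diff (bold_cube G) s (include_A e) = include_A (cube_diff cube_A s e)"
proof (rule ext, clarify)
  fix S y
  show "cube_diff (bold_cube G) s (include_A e) (S, y) = include_A (cube_diff cube_A s e) (S, y)"
  proof (cases "y \<in> bold_cube G S")
    case True
    have "face_sum (bold_cube G) (include_A e) (S - {v}) y = face_sum cube_A e (S - {v}) (y \<inter> A)" for v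
      using face_sum_include_A True by blast
    then have "cube_diff (bold_cube G) s (include_A e) (S, y)
      = (\<Sum>v\<in>S. bit_sign (s (S - {v}) S) * face_sum cube_A e (S - {v}) (y \<inter> A))"
      using True by (simp add: cube_diff_def)
    moreover have "y \<inter> A \<in> cube_A S" if "y \<inter> A \<noteq> {}"
      using that True component_inter_A by (auto simp: cube_A_def bold_cube_def split: if_splits)
    moreover have "face_sum cube_A e S' {} = 0" for S'
      unfolding face_sum_def
      by (rule sum.neutral) (use componentD(1)[OF sym_arcs] in \<open>auto simp: cube_A_def\<close>)
    ultimately show ?thesis using True by (cases "y \<inter> A = {}") (simp_all add: cube_diff_def include_A_def)
  qed (simp add: cube_diff_def include_A_def)
qed

lemma include_A_surj:
  assumes supp: "supported_on (bold_cube G) c" and B: "\<And>S x. x \<subseteq> B \<Longrightarrow> c (S, x) = 0"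
  obtains e where "supported_on cube_A e" "include_A e = c"
proof -
  define e where "e = (\<lambda>(S, z). if z \<in> cube_A S
    then c (S, THE y. y \<in> bold_cube G S \<and> y \<inter> A = z) else 0)"
  have "include_A e (S, y) = c (S, y)" for S y
  proof (cases "y \<in> bold_cube G S \<and> y \<inter> A \<noteq> {}")
    case True
    then have S: "S \<subseteq> pverts G" "y \<in> components G S" by (auto simp: bold_cube_def split: if_splits)
    have "(THE y'. y' \<in> bold_cube G S \<and> y' \<inter> A = y \<inter> A) = y"
    proof (rule the_equality)
      fix y' assume "y' \<in> bold_cube G S \<and> y' \<inter> A = y \<inter> A"
      then show "y' = y"
        using components_eq[OF sym_arcs, of y' S y] S True by (auto simp: bold_cube_def)
    qed (use True in simp)
    moreover have "y \<inter> A \<in> cube_A S" using component_inter_A S True by (simp add: cube_A_def)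
    ultimately show ?thesis using True by (simp add: include_A_def e_def)
  next
    case False
    have "c (S, y) = 0"
    proof (cases "y \<in> bold_cube G S")
      case True
      then have "y \<subseteq> B" using False bold_cube_subset[OF sym_arcs True] verts_eq by blast
      then show ?thesis by (rule B)
    next
      case False
      then show ?thesis using supp by (simp add: supported_on_def)
    qed
    then show ?thesis using False by (auto simp: include_A_def)
  qed
  then have "include_A e = c" by (intro ext) (metis surj_pair)
  moreover have "supported_on cube_A e" by (simp add: supported_on_def e_def)
  ultimately show ?thesis using that by blast
qed

lemma include_A_inject:
  assumes "supported_on cube_A e" "include_A e = 0"
  shows "e = 0"
proof -
  have "e (S, z) = 0" for S z
  proof (cases "z \<in> cube_A S")
    case True
    then have S: "S \<subseteq> pverts G" "z \<in> components G (S \<inter> A)" by (auto simp: cube_A_def split: if_splits)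
    then obtain y where y: "y \<in> components G S" "y \<inter> A = z" using component_of_inter_A by blast
    moreover have "z \<noteq> {}" using S(2) by (rule componentD(1)[OF sym_arcs])
    moreover have "include_A e (S, y) = 0" using assms(2) by simp
    ultimately show ?thesis using S by (simp add: include_A_def bold_cube_def)
  next
    case False
    then show ?thesis using assms by (simp add: supported_on_def)
  qed
  then show ?thesis by (intro ext) (metis surj_pair zero_fun_apply)
qed

text \<open>
  The long exact sequence argument, made explicit. Toggling \<open>a\<close> gives a primitive \<open>e1\<close> of the image
  of the cycle \<open>c\<close> in the quotient. Then \<open>c\<close> minus the differential of \<open>e1\<close> is a cycle that lies in
  the subcomplex, where toggling \<open>b\<close> gives a primitive.
\<close>
lemma cycle_is_boundary:
  fixes c :: "('a, 'k::field) chain"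
  assumes sign: "sign_assignment G s"
    and supp: "supported_on (bold_cube G) c" and cycle: "cube_diff (bold_cube G) s c = 0"
  obtains e where "supported_on (bold_cube G) e" "cube_diff (bold_cube G) s e = c"
proof -
  interpret signed_cube "pverts G" s
    using signed_cube_of_sign_assignment finite_verts sign by blast
  let ?X = "bold_cube G" and ?D = "\<lambda>c :: ('a, 'k) chain. cube_diff (bold_cube G) s c"
  have face_B: "face_sum cube_B d S y = face_sum ?X d S y" if "y \<subseteq> B" for d :: "('a, 'k) chain" and S y
    unfolding face_sum_def using that by (intro sum.cong) (auto simp: cube_B_def)
  have diff_B: "cube_diff cube_B s d (S, y) = (if y \<subseteq> B then ?D d (S, y) else 0)"
    for d :: "('a, 'k) chain" and S y
    by (auto simp: cube_diff_def cube_B_def[of S] face_B)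
  define cB where "cB = (\<lambda>(S, x). if x \<subseteq> B then c (S, x) else 0)"
  have face_cB: "face_sum ?X cB S y = face_sum ?X c S y" if "y \<subseteq> B" for S y
    unfolding face_sum_def using that by (intro sum.cong) (auto simp: cB_def)
  have "cube_diff cube_B s cB (S, y) = 0" for S y
  proof (cases "y \<subseteq> B")
    case True
    have "?D cB (S, y) = ?D c (S, y)" using True by (simp add: cube_diff_def face_cB)
    then show ?thesis using cycle by (simp add: diff_B)
  qed (simp add: diff_B)
  then have cB_cycle: "cube_diff cube_B s cB = 0" by (intro ext) (metis surj_pair zero_fun_apply)
  have cB_supp: "supported_on cube_B cB"
    using supp by (auto simp: supported_on_def cB_def cube_B_def)
  define e1 where "e1 = toggle a cube_B cB"
  have e1: "cube_diff cube_B s e1 = cB"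
    unfolding e1_def
  proof (rule cube_diff_toggle[OF _ _ _ _ cB_supp cB_cycle])
    show "a \<in> pverts G" using a verts_eq by blast
    show "S \<subseteq> pverts G" if "cube_B S \<noteq> {}" for S
      using that bold_cube_subset[OF sym_arcs] by (auto simp: cube_B_def)
    show "cube_B (insert a S) = cube_B S" if "S \<subseteq> pverts G" for S
      using that components_insert_a a verts_eq by (auto simp: cube_B_def bold_cube_def)
    show "x = y" if "x \<in> cube_B S" "y \<in> cube_B S" "x \<subseteq> y" for S x y
      using that components_eq[OF sym_arcs, of x S y] bold_cube_subset(3)[OF sym_arcs, of x S]
      by (auto simp: cube_B_def bold_cube_def split: if_splits)
  qed
  have e1_supp: "supported_on ?X e1"
    using supported_on_toggle[of cube_B a cB] by (auto simp: supported_on_def e1_def cube_B_def)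
  have DD: "?D (?D d) = 0" for d
  proof (rule cube_diff_cube_diff)
    show "S \<subseteq> pverts G" if "?X S \<noteq> {}" for S
      using that bold_cube_subset[OF sym_arcs] by blast
    show "finite (?X S)" for S
      by (rule finite_bold_cube[OF finite_verts sym_arcs])
    show "\<exists>y\<in>?X S'. x \<subseteq> y" if "S \<subseteq> S'" "S' \<subseteq> pverts G" "x \<in> ?X S" for S S' x
      using that component_superset_exists[OF sym_arcs that(1)]
      by (auto simp: bold_cube_def split: if_splits)
    show "y = z" if "S \<subseteq> S'" "x \<in> ?X S" "y \<in> ?X S'" "z \<in> ?X S'" "x \<subseteq> y" "x \<subseteq> z" for S S' x y z
      using that components_eq[OF sym_arcs, of y S' z] bold_cube_subset(3)[OF sym_arcs that(2)]
      by (auto simp: bold_cube_def split: if_splits)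
  qed
  define c1 where "c1 = c - ?D e1"
  have c1_supp: "supported_on ?X c1"
    using supp supported_on_cube_diff[of ?X s e1] by (simp add: supported_on_def c1_def)
  have "c1 (S, x) = 0" if "x \<subseteq> B" for S x
    using that diff_B[of e1 S x] e1 by (simp add: c1_def cB_def)
  then obtain e' where e': "supported_on cube_A e'" "include_A e' = c1"
    using include_A_surj[OF c1_supp] by blast
  have "include_A (cube_diff cube_A s e') = 0"
    using cube_diff_include_A[of s e'] e'(2) cycle DD[of e1]
    by (simp add: c1_def cube_diff_diff)
  then have e'_cycle: "cube_diff cube_A s e' = 0"
    using include_A_inject supported_on_cube_diff by blast
  define e2 where "e2 = include_A (toggle b cube_A e')"
  have "cube_diff cube_A s (toggle b cube_A e') = e'"
  proof (rule cube_diff_toggle[OF _ _ _ _ e'(1) e'_cycle])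
    show "b \<in> pverts G" using b verts_eq by blast
    show "S \<subseteq> pverts G" if "cube_A S \<noteq> {}" for S
      using that by (auto simp: cube_A_def split: if_splits)
    show "cube_A (insert b S) = cube_A S" if "S \<subseteq> pverts G" for S
    proof -
      have "insert b S \<inter> A = S \<inter> A" using b disjoint by blast
      then show ?thesis using that b verts_eq by (auto simp: cube_A_def)
    qed
    show "x = y" if "x \<in> cube_A S" "y \<in> cube_A S" "x \<subseteq> y" for S x y
      using that components_eq[OF sym_arcs, of x "S \<inter> A" y] componentD(1)[OF sym_arcs, of x "S \<inter> A"]
      by (auto simp: cube_A_def split: if_splits)
  qed
  then have e2: "?D e2 = c1" using cube_diff_include_A[of s "toggle b cube_A e'"] e'(2) by (simp add: e2_def)
  have e2_supp: "supported_on ?X e2" by (simp add: supported_on_def e2_def include_A_def)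
  have "?D (e1 + e2) = c" using e2 by (simp add: cube_diff_add c1_def)
  moreover have "supported_on ?X (e1 + e2)" using e1_supp e2_supp by (simp add: supported_on_def)
  ultimately show ?thesis using that by blast
qed

text \<open>A primitive in the total complex is cut down to its part in degree \<open>i - 1\<close>.\<close>
lemma bold_cycles_subset_boundaries:
  assumes sign: "sign_assignment G s"
  shows "bold_cycles G s i \<subseteq> (bold_boundaries G s i :: ('a, 'k::field) chain set)"
proof
  fix c :: "('a, 'k) chain" assume "c \<in> bold_cycles G s i"
  then have c: "c \<in> bold_chains G i" "bold_diff G s i c = 0" by (auto simp: bold_cycles_def)
  let ?X = "bold_cube G"
  have "supported_on ?X c" using c(1) by (auto simp: supported_on_def bold_chains_def in_bold_gens_iff)
  moreover have "cube_diff ?X s c = 0"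
    using c(2) bold_diff_eq_cube_diff[OF finite_verts sym_arcs c(1), of s] by simp
  ultimately obtain e where e: "supported_on ?X e" "cube_diff ?X s e = c"
    using cycle_is_boundary[OF sign] by blast
  define e' where "e' = (\<lambda>(S, x). if int (card S) = i - 1 then e (S, x) else 0)"
  have e'_chain: "e' \<in> bold_chains G (i - 1)"
    unfolding bold_chains_def
  proof (rule CollectI, intro allI impI)
    fix g assume g: "g \<notin> bold_gens G (i - 1)"
    obtain S x where "g = (S, x)" by (cases g)
    then show "e' g = 0" using g e(1) by (auto simp: e'_def supported_on_def in_bold_gens_iff)
  qed
  have "cube_diff ?X s e' (S, y) = c (S, y)" for S y
  proof (cases "y \<in> ?X S")
    case True
    have "finite S" using bold_cube_subset(1)[OF sym_arcs True] finite_verts by (rule finite_subset)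
    then have card: "int (card (S - {v})) = i - 1 \<longleftrightarrow> int (card S) = i" if "v \<in> S" for v
      using that card.remove[of S v] by simp
    show ?thesis
    proof (cases "int (card S) = i")
      case deg: True
      have "cube_diff ?X s e' (S, y) = cube_diff ?X s e (S, y)"
        using True deg card by (simp add: cube_diff_def face_sum_def e'_def)
      then show ?thesis using e by simp
    next
      case deg: False
      have "cube_diff ?X s e' (S, y) = 0"
        using True deg card by (simp add: cube_diff_def face_sum_def e'_def)
      moreover have "c (S, y) = 0" using c(1) deg by (auto simp: bold_chains_def in_bold_gens_iff)
      ultimately show ?thesis by simp
    qed
  next
    case False
    then show ?thesis using c(1) by (auto simp: bold_chains_def in_bold_gens_iff cube_diff_def)
  qed
  then have "cube_diff ?X s e' = c" by (intro ext) (metis surj_pair)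
  then have "c = bold_diff G s (i - 1) e'"
    using bold_diff_eq_cube_diff[OF finite_verts sym_arcs e'_chain, of s] by simp
  then show "c \<in> bold_boundaries G s i"
    unfolding bold_boundaries_def using e'_chain by (rule image_eqI)
qed

end

section \<open>Vanishing homology\<close>

lemma zero_in_bold_boundaries: "0 \<in> bold_boundaries G s i"
proof -
  have "0 = bold_diff G s (i - 1) 0" by (rule ext) (simp add: bold_diff_def)
  moreover have "0 \<in> bold_chains G (i - 1)" by (simp add: bold_chains_def)
  ultimately show ?thesis unfolding bold_boundaries_def by (rule image_eqI)
qed

lemma bold_boundaries_lincomb:
  fixes x y :: "('a, 'k::field) chain"
  assumes "x \<in> bold_boundaries G s i" "y \<in> bold_boundaries G s i"
  shows "(\<lambda>g. t * x g + y g) \<in> bold_boundaries G s i"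
proof -
  obtain u v where u: "u \<in> bold_chains G (i - 1)" "x = bold_diff G s (i - 1) u"
    and v: "v \<in> bold_chains G (i - 1)" "y = bold_diff G s (i - 1) v"
    using assms by (auto simp: bold_boundaries_def)
  have "(\<lambda>g. t * x g + y g) = bold_diff G s (i - 1) (\<lambda>g. t * u g + v g)"
    unfolding u v by (rule ext) (simp add: bold_diff_def sum_distrib_left sum.distrib algebra_simps)
  moreover have "(\<lambda>g. t * u g + v g) \<in> bold_chains G (i - 1)"
    using u v by (simp add: bold_chains_def)
  ultimately show ?thesis unfolding bold_boundaries_def by (rule image_eqI)
qed

lemma bold_boundaries_plus:
  "bold_boundaries G s i + bold_boundaries G s i = (bold_boundaries G s i :: ('a, 'k::field) chain set)"
proof
  show "bold_boundaries G s i + bold_boundaries G s i \<subseteq> (bold_boundaries G s i :: ('a, 'k) chain set)"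
  proof
    fix z :: "('a, 'k) chain" assume "z \<in> bold_boundaries G s i + bold_boundaries G s i"
    then obtain x y where "x \<in> bold_boundaries G s i" "y \<in> bold_boundaries G s i" "z = x + y"
      by (auto elim: set_plus_elim)
    then show "z \<in> bold_boundaries G s i"
      using bold_boundaries_lincomb[of x G s i y 1] by (simp add: plus_fun_def)
  qed
  show "bold_boundaries G s i \<subseteq> (bold_boundaries G s i + bold_boundaries G s i :: ('a, 'k) chain set)"
    using set_zero_plus2[OF zero_in_bold_boundaries] by blast
qed

lemma bold_scale_boundaries:
  "bold_scale G s i t (bold_boundaries G s i) = (bold_boundaries G s i :: ('a, 'k::field) chain set)"
proof
  show "bold_scale G s i t (bold_boundaries G s i) \<subseteq> (bold_boundaries G s i :: ('a, 'k) chain set)"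
    using bold_boundaries_lincomb
    by (auto simp: bold_scale_def plus_fun_def elim!: set_plus_elim)
  have "(0 :: ('a, 'k) chain) \<in> (\<lambda>x g. t * x g) ` bold_boundaries G s i"
    using zero_in_bold_boundaries by (rule rev_image_eqI) auto
  then show "bold_boundaries G s i \<subseteq> (bold_scale G s i t (bold_boundaries G s i) :: ('a, 'k) chain set)"
    unfolding bold_scale_def by (rule set_zero_plus2)
qed

lemma bold_homology_trivial:
  assumes "bold_cycles G s i \<subseteq> (bold_boundaries G s i :: ('a, 'k::field) chain set)"
  shows "bold_homology G s i = {bold_boundaries G s i :: ('a, 'k) chain set}"
proof -
  let ?B = "bold_boundaries G s i :: ('a, 'k) chain set"
  have "z +o ?B = ?B" if z: "z \<in> ?B" for z
  proof
    show "z +o ?B \<subseteq> ?B" using set_plus_mono3[OF z, of ?B] by (simp add: bold_boundaries_plus)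
    show "?B \<subseteq> z +o ?B"
    proof
      fix y assume "y \<in> ?B"
      then have "y - z \<in> ?B" using bold_boundaries_lincomb[OF z, of y "- 1"] by (simp add: fun_diff_def)
      then show "y \<in> z +o ?B" by (auto simp: elt_set_plus_def intro!: bexI[of _ "y - z"])
    qed
  qed
  moreover have "0 \<in> (bold_cycles G s i :: ('a, 'k) chain set)"
    by (auto simp: bold_cycles_def bold_chains_def bold_diff_def fun_eq_iff)
  ultimately show ?thesis unfolding bold_homology_def using assms by blast
qed

text \<open>
  The two groups may have different sets of boundaries as zero element, so the zero map is the
  constant map to the boundaries of the target.
\<close>
lemma bold_homology_iso_trivial:
  assumes "bold_homology G s i = {bold_boundaries G s i :: ('a, 'k::field) chain set}"
    and "bold_homology G' s' j = {bold_boundaries G' s' j :: ('b, 'k) chain set}"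
  shows "bold_homology_iso G s i G' s' j
    (\<lambda>_ :: ('a, 'k) chain set. bold_boundaries G' s' j :: ('b, 'k) chain set)"
  unfolding bold_homology_iso_def assms
  by (simp add: bij_betw_def bold_boundaries_plus bold_scale_boundaries)

section \<open>Two graphs joined by a subdivided edge\<close>

lemma sym_map_prod: "sym R \<Longrightarrow> sym (map_prod f f ` R)"
proof (rule symI)
  fix u w assume R: "sym R" and uw: "(u, w) \<in> map_prod f f ` R"
  obtain a b where ab: "(a, b) \<in> R" "u = f a" "w = f b" using uw by auto
  have "(b, a) \<in> R" using R ab(1) by (rule symD)
  then show "(w, u) \<in> map_prod f f ` R" unfolding ab by (rule rev_image_eqI) simp
qed

text \<open>
  The bridge is the first edge of the path joining the roots; for \<open>k = 0\<close> its far end is \<open>r1\<close>.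
  The vertex \<open>a\<close> comes from an edge of \<open>G0\<close>, at least one end of which is not the root.
\<close>
lemma join_subdivided_bridge_split:
  assumes G0: "pair_graph G0" and r0: "r0 \<in> pverts G0" and ne: "parcs G0 \<noteq> {}"
    and G1: "pair_graph G1" and r1: "r1 \<in> pverts G1"
  obtains a where "bridge_split (join_subdivided G0 r0 G1 r1 k) (Of0 ` pverts G0)
    (Of1 ` pverts G1 \<union> New ` {1..k}) (Of0 r0) (join_path r0 r1 k 1) a (Of1 r1)"
proof -
  interpret G0: pair_graph G0 by fact
  interpret G1: pair_graph G1 by fact
  let ?N = "join_subdivided G0 r0 G1 r1 k"
  obtain u w where uw: "(u, w) \<in> parcs G0" using ne by auto
  then have "u \<in> pverts G0" "w \<in> pverts G0" "u \<noteq> w"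
    using G0.in_arcsD1 G0.in_arcsD2 G0.pair_no_loops by fastforce+
  then obtain v where v: "v \<in> pverts G0" "v \<noteq> r0" by metis
  have sym0: "sym (parcs G0)" and sym1: "sym (parcs G1)"
    using G0.sym_arcs G1.sym_arcs by (simp_all add: symmetric_def)
  have "bridge_split ?N (Of0 ` pverts G0) (Of1 ` pverts G1 \<union> New ` {1..k})
    (Of0 r0) (join_path r0 r1 k 1) (Of0 v) (Of1 r1)"
  proof
    show "finite (pverts ?N)"
      by (simp add: pverts_join_subdivided G0.pair_finite_verts G1.pair_finite_verts)
    show "sym (parcs ?N)"
      unfolding parcs_join_subdivided
      by (intro sym_Un sym_UNION ballI sym_map_prod sym0 sym1) (auto simp: sym_def)
    show "pverts ?N = Of0 ` pverts G0 \<union> (Of1 ` pverts G1 \<union> New ` {1..k})"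
      by (simp add: pverts_join_subdivided Un_assoc)
    show "u = Of0 r0 \<and> w = join_path r0 r1 k 1"
      if "u \<in> Of0 ` pverts G0" "w \<in> Of1 ` pverts G1 \<union> New ` {1..k}" "(u, w) \<in> parcs ?N" for u w
      using that unfolding parcs_join_subdivided by (auto simp: join_path_def split: if_splits)
  qed (use v r1 in auto)
  then show ?thesis by (rule that)
qed

theorem proposition5p8:
  fixes G0 :: "'a pair_pre_digraph" and r0 :: 'a
    and G1 :: "'b pair_pre_digraph" and r1 :: 'b
    and k :: nat and i :: int
    and s s0 :: "('a, 'b) join_vertex set \<Rightarrow> ('a, 'b) join_vertex set \<Rightarrow> bit"
  assumes "pair_graph G0" and "connected (with_proj G0)" and "r0 \<in> pverts G0" and "parcs G0 \<noteq> {}"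
    and "pair_graph G1" and "connected (with_proj G1)" and "r1 \<in> pverts G1" and "parcs G1 \<noteq> {}"
    and "k \<ge> 1"
    and "sign_assignment (join_subdivided G0 r0 G1 r1 k) s"
    and "sign_assignment (join_subdivided G0 r0 G1 r1 0) s0"
  shows "\<exists>\<phi> :: (('a, 'b) join_vertex, 'k::field) chain set \<Rightarrow> (('a, 'b) join_vertex, 'k) chain set.
    bold_homology_iso (join_subdivided G0 r0 G1 r1 k) s (i + int k)
      (join_subdivided G0 r0 G1 r1 0) s0 i \<phi>"
proof -
  have vanish: "bold_homology (join_subdivided G0 r0 G1 r1 m) t j
      = {bold_boundaries (join_subdivided G0 r0 G1 r1 m) t j :: (('a, 'b) join_vertex, 'k) chain set}"
    if "sign_assignment (join_subdivided G0 r0 G1 r1 m) t" for m t j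
  proof -
    obtain a where "bridge_split (join_subdivided G0 r0 G1 r1 m) (Of0 ` pverts G0)
        (Of1 ` pverts G1 \<union> New ` {1..m}) (Of0 r0) (join_path r0 r1 m 1) a (Of1 r1)"
      by (rule join_subdivided_bridge_split[OF assms(1,3,4,5,7)])
    then show ?thesis
      using that by (intro bold_homology_trivial bridge_split.bold_cycles_subset_boundaries)
  qed
  show ?thesis
    by (rule exI) (rule bold_homology_iso_trivial[OF vanish[OF assms(10)] vanish[OF assms(11)]])
qed

end
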